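(* Let $t$ be a positive integer and let $G$ be a minimal counterexample to the following conjecture: every graph on $4t-1$ vertices with independence number $2$ satisfies $\mathrm{cm}(G)\ge t$. That is, $G$ has $4t-1$ vertices, $\alpha(G)=2$ and $\mathrm{cm}(G)\le t-1$, and the conjecture holds for every positive integer $t'<t$. Then for any disjoint subsets $S_1,S_2\subseteq V(G)$ (either of which may be empty) such that $G[S_1]$ and $G[S_2]$ are cliques and $S_1$ is anti-complete to $S_2$, we have $|S_1|+|S_2|\le t-4$.
   Context: All graphs are finite and simple. $\alpha(G)$ is the independence number. A matching $M$ in $G$ is connected if for every two edges of $M$ there is an edge of $G$ joining an endpoint of one to an endpoint of the other; $\mathrm{cm}(G)$ is the maximum size of a connected matching in $G$. Disjoint vertex sets $A,B$ are anti-complete if there is no edge between $A$ and $B$. $G[S]$ denotes the subgraph induced by $S$. *)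

theory Defs
  imports Main
begin

definition simple_graph :: "'a set \<Rightarrow> ('a \<Rightarrow> 'a \<Rightarrow> bool) \<Rightarrow> bool" where
  "simple_graph V E \<longleftrightarrow> finite V \<and>
     (\<forall>u v. E u v \<longrightarrow> u \<in> V \<and> v \<in> V \<and> u \<noteq> v \<and> E v u)"

definition independent_set :: "'a set \<Rightarrow> ('a \<Rightarrow> 'a \<Rightarrow> bool) \<Rightarrow> 'a set \<Rightarrow> bool" where
  "independent_set V E S \<longleftrightarrow> S \<subseteq> V \<and> (\<forall>u\<in>S. \<forall>v\<in>S. \<not> E u v)"

definition independence_number :: "'a set \<Rightarrow> ('a \<Rightarrow> 'a \<Rightarrow> bool) \<Rightarrow> nat" where
  "independence_number V E = Max {card S | S. independent_set V E S}"

definition matching :: "'a set \<Rightarrow> ('a \<Rightarrow> 'a \<Rightarrow> bool) \<Rightarrow> 'a set set \<Rightarrow> bool" where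
  "matching V E M \<longleftrightarrow> (\<forall>e\<in>M. \<exists>u v. e = {u, v} \<and> E u v) \<and>
     (\<forall>e\<in>M. \<forall>f\<in>M. e \<noteq> f \<longrightarrow> e \<inter> f = {})"

definition connected_matching :: "'a set \<Rightarrow> ('a \<Rightarrow> 'a \<Rightarrow> bool) \<Rightarrow> 'a set set \<Rightarrow> bool" where
  "connected_matching V E M \<longleftrightarrow> matching V E M \<and>
     (\<forall>e\<in>M. \<forall>f\<in>M. e \<noteq> f \<longrightarrow> (\<exists>x\<in>e. \<exists>y\<in>f. E x y))"

definition cm :: "'a set \<Rightarrow> ('a \<Rightarrow> 'a \<Rightarrow> bool) \<Rightarrow> nat" where
  "cm V E = Max {card M | M. connected_matching V E M}"

definition clique :: "'a set \<Rightarrow> ('a \<Rightarrow> 'a \<Rightarrow> bool) \<Rightarrow> 'a set \<Rightarrow> bool" where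
  "clique V E S \<longleftrightarrow> S \<subseteq> V \<and> (\<forall>u\<in>S. \<forall>v\<in>S. u \<noteq> v \<longrightarrow> E u v)"

definition anti_complete :: "('a \<Rightarrow> 'a \<Rightarrow> bool) \<Rightarrow> 'a set \<Rightarrow> 'a set \<Rightarrow> bool" where
  "anti_complete E A B \<longleftrightarrow> A \<inter> B = {} \<and> (\<forall>u\<in>A. \<forall>v\<in>B. \<not> E u v)"

end

theory Submission
  imports Defs
begin

text \<open>
  Suppose \<open>|S1| + |S2| = k = t - j\<close> with \<open>0 \<le> j \<le> 3\<close>. Every closed non-neighbourhood has at most
  \<open>k\<close> vertices: for \<open>j > 0\<close> choose the pair with \<open>k\<close> maximal, and for \<open>j = 0\<close> use that cliques have
  fewer than \<open>t\<close> vertices (a clique of size \<open>t\<close> can be matched into its complement). Let \<open>R\<close> be the set of remaining vertices. As there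
  are no independent triples, every vertex of \<open>R\<close> is complete to \<open>S1\<close> or to \<open>S2\<close>. We take a
  connected matching \<open>M\<close> of size \<open>j\<close> in \<open>R\<close> and match all of \<open>S1 \<union> S2\<close> greedily into \<open>R\<close>,
  which gives a connected matching of size \<open>t\<close>. Two kinds of conflict have to be avoided.

  An edge from \<open>S1\<close> and an edge from \<open>S2\<close> are certainly joined if \<open>S1\<close> is matched to vertices
  complete to \<open>S2\<close>, or symmetrically; counting shows that one of the two options has enough room.

  An edge at \<open>s\<close> may miss \<open>e \<in> M\<close> only if both its ends are non-adjacent to \<open>e\<close>. If the union of
  any two edges of \<open>M\<close> contains a non-edge, at most one \<open>e\<close> is dangerous for each \<open>s\<close>, since the
  non-neighbours of \<open>s\<close> form a clique. If the complement of \<open>G[R]\<close> has a 5-cycle, three such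
  edges are found on it together with one further vertex. Otherwise, for each \<open>u \<in> R\<close>, the vertices
  at distance at most 2 from \<open>u\<close> in the complement are covered by two cliques, so some \<open>w\<close> lies
  further away: then \<open>uw\<close> dominates \<open>R\<close>, and any \<open>j\<close> disjoint edges of this kind can serve as \<open>M\<close>.
\<close>

section \<open>Preliminaries: cliques and systems of representatives\<close>

lemma cliqueD: "clique V E S \<Longrightarrow> u \<in> S \<Longrightarrow> v \<in> S \<Longrightarrow> u \<noteq> v \<Longrightarrow> E u v"
  by (simp add: clique_def)

lemma clique_subset: "clique V E S \<Longrightarrow> T \<subseteq> S \<Longrightarrow> clique V E T"
  by (auto simp: clique_def)

text \<open>A greedy substitute for Hall's theorem: an \<open>s\<close> with at least
  \<open>card S\<close> candidates is served last, when only \<open>card S - 1\<close> values are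
  taken.\<close>

lemma system_of_representatives:
  assumes "finite S"
    and "\<And>T. T \<subseteq> S \<Longrightarrow> T \<noteq> {} \<Longrightarrow> \<exists>s\<in>T. finite (F s) \<and> card T \<le> card (F s)"
  shows "\<exists>f. inj_on f S \<and> (\<forall>s\<in>S. f s \<in> F s)"
  using assms
proof (induction "card S" arbitrary: S)
  case 0
  then show ?case by auto
next
  case (Suc n)
  then have "S \<noteq> {}" by auto
  with Suc.prems(2)[of S] obtain s where s: "s \<in> S" "finite (F s)" "card S \<le> card (F s)"
    by auto
  have "n = card (S - {s})" using Suc.hyps(2) s(1) Suc.prems(1) by simp
  moreover have "\<exists>x\<in>T. finite (F x) \<and> card T \<le> card (F x)" if "T \<subseteq> S - {s}" "T \<noteq> {}" for T
    using that by (intro Suc.prems(2)) auto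
  ultimately obtain f where f: "inj_on f (S - {s})" "\<forall>x\<in>S - {s}. f x \<in> F x"
    using Suc.hyps(1)[of "S - {s}"] Suc.prems(1) by auto
  have "card (f ` (S - {s})) < card (F s)"
    using card_image[OF f(1)] \<open>n = card (S - {s})\<close> Suc.hyps(2) s(3) by simp
  then have "\<not> F s \<subseteq> f ` (S - {s})"
    using Suc.prems(1) card_mono[of "f ` (S - {s})" "F s"] by auto
  then obtain y where y: "y \<in> F s" "y \<notin> f ` (S - {s})" by blast
  have "inj_on (f(s := y)) (insert s (S - {s}))"
    using f(1) y(2) by (auto simp: inj_on_def)
  then have "inj_on (f(s := y)) S" using s(1) by (simp add: insert_absorb)
  moreover have "\<forall>x\<in>S. (f(s := y)) x \<in> F x" using f(2) y(1) by auto
  ultimately show ?case by blast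
qed

lemma image_Un_pair_cases:
  assumes "e \<in> g ` S \<union> M" "h \<in> g ` S \<union> M" "e \<noteq> h"
  obtains "e \<in> M" "h \<in> M"
  | s where "s \<in> S" "e = g s" "h \<in> M"
  | s where "s \<in> S" "h = g s" "e \<in> M"
  | s r where "s \<in> S" "r \<in> S" "s \<noteq> r" "e = g s" "h = g r"
  using assms by blast

text \<open>Serves to bound the blocking edges of each clique when only two edges can block and none
  blocks both cliques.\<close>

lemma disjoint_subsets_doubleton:
  assumes "X \<subseteq> {p, q}" "Y \<subseteq> {p, q}" "X \<inter> Y = {}"
  shows "X = {} \<or> Y = {} \<or> (\<exists>e. X \<subseteq> {e}) \<and> (\<exists>e. Y \<subseteq> {e})"
proof -
  have "X \<subseteq> {p} \<or> p \<in> X \<and> q \<in> X \<or> X \<subseteq> {q}" "Y \<subseteq> {p} \<or> p \<in> Y \<and> q \<in> Y \<or> Y \<subseteq> {q}"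
    using assms(1,2) by blast+
  moreover have "Z = {}" if "Z \<subseteq> {p, q}" "p \<notin> Z" "q \<notin> Z" for Z
    using that by blast
  ultimately show ?thesis using assms by (metis disjoint_iff)
qed

section \<open>Graphs without independent triples\<close>

locale independence_two =
  fixes V :: "'a set" and E :: "'a \<Rightarrow> 'a \<Rightarrow> bool"
  assumes simple: "simple_graph V E"
    and no_three: "\<And>u v w. \<lbrakk>u \<in> V; v \<in> V; w \<in> V; u \<noteq> v; u \<noteq> w; v \<noteq> w\<rbrakk>
      \<Longrightarrow> E u v \<or> E u w \<or> E v w"
begin

text \<open>Both sets are closed: \<open>v \<in> nonadj v\<close>. No end of an edge \<open>e\<close> lies in \<open>undominated e\<close>.\<close>

definition nonadj :: "'a \<Rightarrow> 'a set" where
  "nonadj v = {z \<in> V. \<not> E v z}"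

definition undominated :: "'a set \<Rightarrow> 'a set" where
  "undominated e = {z \<in> V. \<forall>x\<in>e. \<not> E x z}"

lemma finite_V [simp]: "finite V"
  using simple by (simp add: simple_graph_def)

lemma adj_sym: "E u v \<Longrightarrow> E v u"
  and adj_irrefl [simp]: "\<not> E u u"
  and adj_in_V: "E u v \<Longrightarrow> u \<in> V \<and> v \<in> V"
  using simple by (auto simp: simple_graph_def)

lemma adj_commute: "E u v \<longleftrightarrow> E v u"
  using adj_sym by blast

lemma finite_subset_V: "S \<subseteq> V \<Longrightarrow> finite S"
  by (rule finite_subset[OF _ finite_V])

lemma finite_nonadj [simp]: "finite (nonadj v)"
  and finite_undominated [simp]: "finite (undominated e)"
  by (simp_all add: nonadj_def undominated_def)

lemma undominated_subset_nonadj: "x \<in> e \<Longrightarrow> undominated e \<subseteq> nonadj x"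
  by (auto simp: nonadj_def undominated_def)

text \<open>Two non-adjacent vertices here would form an independent triple with
  \<open>v\<close>.\<close>

lemma clique_nonadj:
  assumes "v \<in> V"
  shows "clique V E (nonadj v - {v})"
  using no_three[OF assms] by (auto simp: clique_def nonadj_def)

lemma matchingD:
  assumes "matching V E M" "e \<in> M"
  obtains u v where "e = {u, v}" "E u v"
  using assms by (auto simp: matching_def)

lemma matching_Union_subset:
  assumes "matching V E M"
  shows "\<Union>M \<subseteq> V"
proof
  fix x assume "x \<in> \<Union>M"
  then obtain e where e: "e \<in> M" "x \<in> e" by blast
  obtain u v where "e = {u, v}" "E u v" by (rule matchingD[OF assms e(1)])
  then show "x \<in> V" using e(2) adj_in_V by blast
qed

lemma finite_matching: "matching V E M \<Longrightarrow> finite M"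
  by (rule finite_UnionD) (rule finite_subset_V[OF matching_Union_subset])

lemma card_Union_matching:
  assumes "matching V E M"
  shows "card (\<Union>M) \<le> 2 * card M"
proof -
  have "card (\<Union>M) \<le> (\<Sum>e\<in>M. card e)"
    by (rule card_Union_le_sum_card)
  also have "\<dots> \<le> (\<Sum>e\<in>M. 2)"
    by (rule sum_mono) (use assms in \<open>auto simp: matching_def card_insert_if\<close>)
  finally show ?thesis by simp
qed

lemma card_le_cm:
  assumes "connected_matching V E M"
  shows "card M \<le> cm V E"
proof -
  have "{M. connected_matching V E M} \<subseteq> Pow (Pow V)"
    by (auto simp: connected_matching_def dest!: matching_Union_subset)
  then have "finite {M. connected_matching V E M}"
    by (rule finite_subset) simp
  then have "finite {card M |M. connected_matching V E M}" by simp
  then show ?thesis unfolding cm_def using assms by (intro Max_ge) auto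
qed

section \<open>Connected matchings grown from cliques\<close>

lemma connected_matching_subset:
  "connected_matching V E M \<Longrightarrow> N \<subseteq> M \<Longrightarrow> connected_matching V E N"
  unfolding connected_matching_def matching_def by (simp add: subset_iff)

text \<open>Edges at one clique are joined inside it, edges at different cliques through
  \<open>f12\<close>, and the edge at \<open>s\<close> is joined to \<open>e \<in> M\<close> because
  \<open>s\<close> or \<open>f s\<close> has a neighbour in \<open>e\<close>.\<close>

lemma connected_matching_extend:
  assumes cl: "clique V E S1" "clique V E S2" and disj: "S1 \<inter> S2 = {}"
    and M: "connected_matching V E M" and MS: "\<Union>M \<inter> (S1 \<union> S2) = {}"
    and inj: "inj_on f (S1 \<union> S2)"
    and fE: "\<And>s. s \<in> S1 \<union> S2 \<Longrightarrow> E s (f s) \<and> f s \<notin> S1 \<union> S2 \<union> \<Union>M"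
    and f12: "\<And>s r. s \<in> S1 \<Longrightarrow> r \<in> S2 \<Longrightarrow> E (f s) r"
    and fM: "\<And>s e. s \<in> S1 \<union> S2 \<Longrightarrow> e \<in> M \<Longrightarrow> s \<in> undominated e \<Longrightarrow> f s \<notin> undominated e"
  shows "card S1 + card S2 + card M \<le> cm V E"
proof -
  let ?S = "S1 \<union> S2" and ?g = "\<lambda>s. {s, f s}"
  have inV: "s \<in> V \<and> f s \<in> V" if "s \<in> ?S" for s
    using fE[OF that] adj_in_V by blast
  have mM: "matching V E M" using M by (simp add: connected_matching_def)
  have fin: "finite S1" "finite S2"
    using cl finite_subset_V by (auto simp: clique_def)
  have ginj: "inj_on ?g ?S"
    using fE by (auto simp: inj_on_def doubleton_eq_iff)
  have gM: "?g ` ?S \<inter> M = {}" using MS by blast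
  have near: "\<exists>x\<in>e. \<exists>y\<in>?g s. E x y" if "s \<in> ?S" "e \<in> M" for s e
  proof (cases "s \<in> undominated e")
    case True
    then have "f s \<notin> undominated e" using fM that by blast
    then show ?thesis using inV[OF that(1)] by (auto simp: undominated_def)
  next
    case False
    then show ?thesis using inV[OF that(1)] by (auto simp: undominated_def)
  qed
  have near': "\<exists>x\<in>?g s. \<exists>y\<in>e. E x y" if "s \<in> ?S" "e \<in> M" for s e
    using near[OF that] adj_sym by blast
  have SS: "\<exists>x\<in>?g s. \<exists>y\<in>?g r. E x y" if "s \<in> ?S" "r \<in> ?S" "s \<noteq> r" for s r
    using that cl f12 adj_sym unfolding clique_def by blast
  have gdisj: "?g s \<inter> ?g r = {}" if "s \<in> ?S" "r \<in> ?S" "s \<noteq> r" for s r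
    using that fE inj by (auto simp: inj_on_def)
  have gMdisj: "?g s \<inter> e = {}" if "s \<in> ?S" "e \<in> M" for s e
    using that fE MS by blast
  have "matching V E (?g ` ?S \<union> M)"
    unfolding matching_def
  proof (intro conjI ballI impI)
    fix e assume "e \<in> ?g ` ?S \<union> M"
    then consider s where "s \<in> ?S" "e = ?g s" | "e \<in> M" by blast
    then show "\<exists>u v. e = {u, v} \<and> E u v"
    proof cases
      case 1
      then show ?thesis using fE[of s] by blast
    next
      case 2
      then show ?thesis using mM by (auto simp: matching_def)
    qed
  next
    fix e h assume eh: "e \<in> ?g ` ?S \<union> M" "h \<in> ?g ` ?S \<union> M" "e \<noteq> h"
    from eh show "e \<inter> h = {}"
    proof (cases rule: image_Un_pair_cases)
      case 1
      then show ?thesis using mM eh(3) by (auto simp: matching_def)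
    next
      case (2 s)
      then show ?thesis using gMdisj by blast
    next
      case (3 s)
      then show ?thesis using gMdisj by blast
    next
      case (4 s r)
      then show ?thesis using gdisj[OF 4(1-3)] by simp
    qed
  qed
  moreover have "\<exists>x\<in>e. \<exists>y\<in>h. E x y"
    if eh: "e \<in> ?g ` ?S \<union> M" "h \<in> ?g ` ?S \<union> M" "e \<noteq> h" for e h
    using eh
  proof (cases rule: image_Un_pair_cases)
    case 1
    then show ?thesis using M eh(3) by (auto simp: connected_matching_def)
  next
    case (2 s)
    show ?thesis using near'[OF 2(1,3)] unfolding 2(2) .
  next
    case (3 s)
    show ?thesis using near[OF 3(1,3)] unfolding 3(2) .
  next
    case (4 s r)
    show ?thesis using SS[OF 4(1-3)] unfolding 4(4,5) .
  qed
  ultimately have "connected_matching V E (?g ` ?S \<union> M)"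
    by (auto simp: connected_matching_def)
  then have "card (?g ` ?S \<union> M) \<le> cm V E" by (rule card_le_cm)
  moreover have "card (?g ` ?S \<union> M) = card S1 + card S2 + card M"
    using gM ginj fin disj finite_matching[OF mM]
    by (simp add: card_Un_disjoint card_image del: image_Un)
  ultimately show ?thesis by simp
qed

text \<open>If every vertex of \<open>S\<close> has \<open>t\<close> neighbours outside,
  \<open>S\<close> is matched greedily. Otherwise some \<open>s\<close> has so many non-neighbours
  that they form a clique of size at least \<open>2 * t\<close>, in which \<open>t\<close> vertices
  are matched to the others.\<close>

lemma cm_ge_of_clique:
  assumes V: "card V + 1 = 4 * t" and S: "clique V E S" "card S = t"
  shows "t \<le> cm V E"
proof -
  have emptyM: "connected_matching V E {}"
    by (simp add: connected_matching_def matching_def)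
  have extend: "t \<le> cm V E"
    if S: "clique V E S" "card S = t" and F: "\<And>s. s \<in> S \<Longrightarrow> t \<le> card {z \<in> V - S. E s z}" for S
  proof -
    have fin: "finite S" using S finite_subset_V by (auto simp: clique_def)
    have "\<exists>f. inj_on f S \<and> (\<forall>s\<in>S. f s \<in> {z \<in> V - S. E s z})"
    proof (rule system_of_representatives[OF fin])
      fix T assume T: "T \<subseteq> S" "T \<noteq> {}"
      then obtain s where "s \<in> T" by blast
      with T F[of s] card_mono[OF fin T(1)] S(2)
      show "\<exists>s\<in>T. finite {z \<in> V - S. E s z} \<and> card T \<le> card {z \<in> V - S. E s z}"
        by (intro bexI[of _ s]) auto
    qed
    then obtain f where "inj_on f S" "\<forall>s\<in>S. f s \<in> {z \<in> V - S. E s z}" by blast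
    then have "card S + card ({} :: 'a set) + card ({} :: 'a set set) \<le> cm V E"
      using S(1) emptyM
      by (intro connected_matching_extend[where f = f]) (auto simp: clique_def)
    then show ?thesis using S(2) by simp
  qed
  show ?thesis
  proof (cases "\<forall>s\<in>S. t \<le> card {z \<in> V - S. E s z}")
    case True
    then show ?thesis using extend S by blast
  next
    case False
    then obtain s where s: "s \<in> S" "card {z \<in> V - S. E s z} < t" by auto
    have SV: "S \<subseteq> V" "s \<in> V" "finite S"
      using S s finite_subset_V by (auto simp: clique_def)
    let ?Q = "nonadj s - {s}"
    have "V \<subseteq> {z \<in> V - S. E s z} \<union> S \<union> ?Q" by (auto simp: nonadj_def s(1))
    then have "card V \<le> card ({z \<in> V - S. E s z} \<union> S \<union> ?Q)"
      using SV by (intro card_mono) auto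
    also have "\<dots> \<le> card {z \<in> V - S. E s z} + card S + card ?Q"
      by (meson add_le_mono1 card_Un_le le_trans)
    \<comment> \<open>At most \<open>t - 1\<close> outer neighbours of \<open>s\<close> and the
      \<open>t\<close> vertices of \<open>S\<close> are taken from \<open>4 * t - 1\<close>.\<close>
    finally have Q: "2 * t \<le> card ?Q" using V s(2) S(2) by linarith
    then obtain S' where S': "S' \<subseteq> ?Q" "card S' = t"
      using obtain_subset_with_card_n[of t ?Q] by auto
    have clQ: "clique V E ?Q" using SV clique_nonadj by blast
    show ?thesis
    proof (rule extend[OF _ S'(2)])
      show "clique V E S'" by (rule clique_subset[OF clQ S'(1)])
      fix x assume x: "x \<in> S'"
      have "E x z" if "z \<in> ?Q - S'" for z
        using that x S'(1) by (intro cliqueD[OF clQ]) auto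
      then have "?Q - S' \<subseteq> {z \<in> V - S'. E x z}"
        using clQ by (auto simp: clique_def)
      then have "card (?Q - S') \<le> card {z \<in> V - S'. E x z}"
        by (intro card_mono) auto
      moreover have "card (?Q - S') = card ?Q - t"
        using S' by (simp add: card_Diff_subset finite_subset)
      ultimately show "t \<le> card {z \<in> V - S'. E x z}" using Q by linarith
    qed
  qed
qed

subsection \<open>Matching a pair of anti-complete cliques\<close>

text \<open>An edge between \<open>S\<close> and \<open>R\<close> fails to be joined to
  \<open>e\<close> only if both its ends are undominated by \<open>e\<close>, so edges of
  \<open>M\<close> outside this set put no restriction on the partners of \<open>S\<close>.\<close>

definition blocking :: "'a set set \<Rightarrow> 'a set \<Rightarrow> 'a set \<Rightarrow> 'a set set" where
  "blocking M S R = {e \<in> M. undominated e \<inter> S \<noteq> {} \<and> undominated e \<inter> R \<noteq> {}}"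

text \<open>\<open>nonadj s\<close> also contains \<open>S2\<close> and \<open>s\<close> itself,
  which accounts for the \<open>+ 1\<close>.\<close>

lemma card_nonadj_outside:
  assumes "s \<in> S1" "S1 \<subseteq> V" "S2 \<subseteq> V" "anti_complete E S1 S2"
  shows "card (nonadj s \<inter> (V - (S1 \<union> S2))) + card S2 + 1 \<le> card (nonadj s)"
proof -
  let ?N = "nonadj s \<inter> (V - (S1 \<union> S2))"
  have S2: "s \<notin> S2" "finite S2"
    using assms finite_subset_V by (auto simp: anti_complete_def)
  have "card ?N + card S2 + 1 = card (?N \<union> insert s S2)"
    using assms(1) S2 by (subst card_Un_disjoint) auto
  also have "\<dots> \<le> card (nonadj s)"
    using assms by (intro card_mono) (auto simp: nonadj_def anti_complete_def)
  finally show ?thesis .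
qed

text \<open>\<open>S1\<close> is matched into \<open>B\<close>, which joins its edges to those at
  \<open>S2\<close>; \<open>S2\<close> may use all of \<open>R\<close>. The alternatives in
  \<open>block\<close>: no edge endangers \<open>S1\<close>; \<open>B\<close> can afford to lose the
  vertices undominated by one edge; or a single edge endangers \<open>S1\<close>, and then
  \<open>card S1\<close> is counted only once.\<close>

lemma cm_ge_one_side:
  fixes S1 S2 :: "'a set" and M :: "'a set set"
  defines "R \<equiv> V - (S1 \<union> S2)" and "k \<equiv> card S1 + card S2"
  defines "B \<equiv> {z \<in> R. \<forall>r\<in>S2. E z r}"
  assumes cl: "clique V E S1" "clique V E S2" and anti: "anti_complete E S1 S2"
    and M: "connected_matching V E M" and MR: "\<Union>M \<subseteq> R"
    and V: "card V + 1 = 4 * (k + card M)"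
    and nonadj: "\<And>v. v \<in> V \<Longrightarrow> card (nonadj v) \<le> k"
    and once: "\<And>s e h. \<lbrakk>s \<in> S1 \<union> S2; e \<in> M; h \<in> M; s \<in> undominated e; s \<in> undominated h;
      undominated e \<inter> R \<noteq> {}; undominated h \<inter> R \<noteq> {}\<rbrakk> \<Longrightarrow> e = h"
    and B: "2 * card M + 2 * card S1 \<le> card B + 1"
    and block: "blocking M S1 R = {}
      \<or> 2 * card M + 2 * card S1 + k \<le> card B + 2
      \<or> (\<exists>e. blocking M S1 R \<subseteq> {e}) \<and> 2 * card M + card S1 + k \<le> card B + 1"
  shows "k + card M \<le> cm V E"
proof -
  have mM: "matching V E M" using M by (simp add: connected_matching_def)
  have SV: "S1 \<subseteq> V" "S2 \<subseteq> V" and disj: "S1 \<inter> S2 = {}"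
    using cl anti by (auto simp: clique_def anti_complete_def)
  have fin: "finite S1" "finite S2" "finite R" "finite B"
    using SV finite_subset_V by (auto simp: R_def B_def)
  have finM: "finite (\<Union>M)" using matching_Union_subset[OF mM] finite_subset_V by blast
  have cardU: "card (\<Union>M) \<le> 2 * card M" by (rule card_Union_matching[OF mM])
  have cardR: "card R + 1 = 3 * k + 4 * card M"
    using V SV fin disj by (simp add: R_def k_def card_Diff_subset card_Un_disjoint)
  have anti': "anti_complete E S2 S1"
    using anti unfolding anti_complete_def by (blast dest: adj_sym)
  have nonadj1: "card (nonadj s \<inter> R) + 1 \<le> card S1" if "s \<in> S1" for s
    using card_nonadj_outside[OF that SV anti] nonadj[of s] that SV
    unfolding R_def[symmetric] k_def by fastforce
  have nonadj2: "card (nonadj s \<inter> R) + 1 \<le> card S2" if "s \<in> S2" for s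
    using card_nonadj_outside[OF that SV(2,1) anti'] nonadj[of s] that SV
    unfolding Un_commute[of S2] R_def[symmetric] k_def by fastforce
  \<comment> \<open>The two parts are disjoint and both lie in the closed non-neighbourhood of an
    end of \<open>e\<close>.\<close>
  have und: "card (undominated e \<inter> R) + card (undominated e \<inter> S1) \<le> k" if e: "e \<in> M" for e
  proof -
    obtain x y where xy: "e = {x, y}" "E x y" by (rule matchingD[OF mM e])
    have "card (undominated e \<inter> R) + card (undominated e \<inter> S1)
      = card (undominated e \<inter> R \<union> undominated e \<inter> S1)"
      by (subst card_Un_disjoint) (auto simp: R_def)
    also have "\<dots> \<le> card (nonadj x)"
      using undominated_subset_nonadj[of x e] xy(1) by (intro card_mono) auto
    also have "\<dots> \<le> k" using nonadj xy(2) adj_in_V by blast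
    finally show ?thesis .
  qed
  define D where "D s = (if s \<in> S1 then B else R)" for s
  define F where "F s = {z \<in> D s. z \<notin> \<Union>M \<and> E s z \<and>
    (\<forall>e\<in>M. s \<in> undominated e \<longrightarrow> z \<notin> undominated e)}" for s
  have DR: "D s \<subseteq> R" for s by (auto simp: D_def B_def)
  have RV: "R \<subseteq> V" by (auto simp: R_def)
  have finF: "finite (F s)" for s
    by (rule finite_subset[OF _ fin(3)]) (use DR in \<open>auto simp: F_def\<close>)
  \<comment> \<open>Apart from vertices of \<open>M\<close> and non-neighbours of \<open>s\<close>,
    the only candidates lost are those in \<open>X\<close>, which has to contain every partner
    unsafe for \<open>s\<close>.\<close>
  have count: "card (D s) \<le> card (F s) + 2 * card M + card (nonadj s \<inter> R) + card X"
    if X: "\<And>e z. e \<in> M \<Longrightarrow> s \<in> undominated e \<Longrightarrow> z \<in> undominated e \<Longrightarrow> z \<in> R \<Longrightarrow> z \<in> X"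
      "finite X" for s X
  proof -
    have "D s \<subseteq> F s \<union> \<Union>M \<union> (nonadj s \<inter> R) \<union> X"
    proof
      fix z assume z: "z \<in> D s"
      then have "z \<in> R" "z \<in> V" using DR RV by auto
      then show "z \<in> F s \<union> \<Union>M \<union> (nonadj s \<inter> R) \<union> X"
        using z X(1)[of _ z] by (auto simp: F_def nonadj_def)
    qed
    then have "card (D s) \<le> card (F s \<union> \<Union>M \<union> (nonadj s \<inter> R) \<union> X)"
      using finF finM X(2) by (intro card_mono) auto
    also have "\<dots> \<le> card (F s) + card (\<Union>M) + card (nonadj s \<inter> R) + card X"
      by (meson add_le_mono1 card_Un_le le_trans)
    finally show ?thesis using cardU by linarith
  qed
  \<comment> \<open>By \<open>once\<close> a single edge \<open>e\<close> accounts for all unsafe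
    partners of \<open>s\<close>, so \<open>undominated e \<inter> R\<close> serves as
    \<open>X\<close>.\<close>
  have blocked: "\<exists>e\<in>M. s \<in> undominated e \<and> card (D s) \<le>
      card (F s) + 2 * card M + card (nonadj s \<inter> R) + card (undominated e \<inter> R)
      \<and> (s \<in> S1 \<longrightarrow> e \<in> blocking M S1 R)"
    if s: "s \<in> S1 \<union> S2" "\<not> card (D s) \<le> card (F s) + 2 * card M + card (nonadj s \<inter> R)" for s
  proof -
    obtain e z where e: "e \<in> M" "s \<in> undominated e" "z \<in> undominated e" "z \<in> R"
      using count[of s "{}"] s(2) by auto
    have "z' \<in> undominated e \<inter> R"
      if "h \<in> M" "s \<in> undominated h" "z' \<in> undominated h" "z' \<in> R" for h z'
      using once[OF s(1) e(1) that(1) e(2) that(2)] e that by blast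
    then have "card (D s) \<le>
      card (F s) + 2 * card M + card (nonadj s \<inter> R) + card (undominated e \<inter> R)"
      by (intro count) auto
    then show ?thesis using e by (intro bexI[of _ e]) (auto simp: blocking_def)
  qed
  text \<open>The degeneracy condition is met by preferring, within \<open>T\<close>, vertices of \<open>S2\<close>, then
    vertices of \<open>S1\<close> without a dangerous edge. If one edge \<open>e\<close> is dangerous for all of
    \<open>T \<subseteq> S1\<close>, then \<open>T\<close> and the forbidden part of \<open>R\<close> share the clique \<open>undominated e\<close>.\<close>
  have "\<exists>f. inj_on f (S1 \<union> S2) \<and> (\<forall>s\<in>S1 \<union> S2. f s \<in> F s)"
  proof (rule system_of_representatives)
    fix T assume T: "T \<subseteq> S1 \<union> S2" "T \<noteq> {}"
    have Tk: "card T \<le> k"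
      using card_mono[OF _ T(1)] fin disj by (simp add: k_def card_Un_disjoint)
    have "\<exists>s\<in>T. card T \<le> card (F s)"
    proof (cases "T \<subseteq> S1")
      case False
      then obtain s where s: "s \<in> T" "s \<in> S2" "s \<notin> S1" using T(1) by blast
      \<comment> \<open>Of the \<open>3 * k + 4 * card M - 1\<close> vertices of \<open>R\<close>,
        at most \<open>2 * card M\<close>, \<open>card S2 - 1\<close> and \<open>k\<close> are lost,
        which leaves at least \<open>k\<close>.\<close>
      have "card (undominated e \<inter> R) \<le> k" if "e \<in> M" for e using und[OF that] by linarith
      then have "card (D s) \<le> card (F s) + 2 * card M + card (nonadj s \<inter> R) + k"
        using blocked[of s] s(2) by fastforce
      then have "k \<le> card (F s)"
        using s(3) nonadj2[OF s(2)] cardR unfolding D_def k_def by simp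
      then show ?thesis using Tk s(1) by (intro bexI[of _ s]) auto
    next
      case True
      have T1: "card T \<le> card S1" using True fin(1) by (simp add: card_mono)
      show ?thesis
      proof (cases "\<exists>s\<in>T. card (D s) \<le> card (F s) + 2 * card M + card (nonadj s \<inter> R)")
        case True
        then obtain s where s: "s \<in> T" "s \<in> S1"
          "card B \<le> card (F s) + 2 * card M + card (nonadj s \<inter> R)"
          using \<open>T \<subseteq> S1\<close> by (auto simp: D_def)
        then have "card S1 \<le> card (F s)" using nonadj1[OF s(2)] B by linarith
        then show ?thesis using T1 s(1) by (intro bexI[of _ s]) auto
      next
        case False
        have "\<exists>e\<in>blocking M S1 R. s \<in> undominated e \<and>
          card B \<le> card (F s) + 2 * card M + card (nonadj s \<inter> R) + card (undominated e \<inter> R)"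
          if "s \<in> T" for s
          using blocked[of s] False that \<open>T \<subseteq> S1\<close> by (fastforce simp: D_def)
        then obtain e where e: "\<And>s. s \<in> T \<Longrightarrow> e s \<in> blocking M S1 R \<and> s \<in> undominated (e s) \<and>
          card B \<le> card (F s) + 2 * card M + card (nonadj s \<inter> R) + card (undominated (e s) \<inter> R)"
          by metis
        obtain s where s: "s \<in> T" using T(2) by blast
        have es: "card B \<le> card (F s) + 2 * card M + card (nonadj s \<inter> R) + card (undominated (e s) \<inter> R)"
          "e s \<in> M" "s \<in> undominated (e s) \<inter> S1" "s \<in> S1"
          using e[OF s] s \<open>T \<subseteq> S1\<close> by (auto simp: blocking_def)
        have "card T \<le> card (F s)"
        proof (cases "2 * card M + 2 * card S1 + k \<le> card B + 2")
          case True
          \<comment> \<open>Since \<open>s\<close> is undominated by \<open>e s\<close>, at most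
            \<open>k - 1\<close> vertices of \<open>R\<close> are; hence the \<open>+ 2\<close> in
            this alternative.\<close>
          have "card (undominated (e s) \<inter> S1) \<noteq> 0" using es(3) fin(1) by auto
          then have "card S1 \<le> card (F s)"
            using und[OF es(2)] es(1) nonadj1[OF es(4)] True by linarith
          then show ?thesis using T1 by simp
        next
          case False
          then obtain h where h: "blocking M S1 R \<subseteq> {h}"
            "2 * card M + card S1 + k \<le> card B + 1"
            using block e[OF s] by auto
          have "T \<subseteq> undominated (e s) \<inter> S1"
          proof
            fix x assume "x \<in> T"
            then have "e x = e s" "x \<in> undominated (e x)" using e h(1) s by blast+
            then show "x \<in> undominated (e s) \<inter> S1" using \<open>x \<in> T\<close> \<open>T \<subseteq> S1\<close> by auto
          qed
          then have "card T \<le> card (undominated (e s) \<inter> S1)"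
            using fin(1) by (intro card_mono) auto
          then show ?thesis using und[OF es(2)] es(1) nonadj1[OF es(4)] h(2) by linarith
        qed
        then show ?thesis using s by blast
      qed
    qed
    then show "\<exists>s\<in>T. finite (F s) \<and> card T \<le> card (F s)" using finF by blast
  qed (use fin in simp)
  then obtain f where f: "inj_on f (S1 \<union> S2)" "\<And>s. s \<in> S1 \<union> S2 \<Longrightarrow> f s \<in> F s" by blast
  show ?thesis
    unfolding k_def
  proof (rule connected_matching_extend[OF cl disj M _ f(1)])
    show "\<Union>M \<inter> (S1 \<union> S2) = {}" using MR by (auto simp: R_def)
    show "E s (f s) \<and> f s \<notin> S1 \<union> S2 \<union> \<Union>M" if "s \<in> S1 \<union> S2" for s
      using f(2)[OF that] DR[of s] by (auto simp: F_def R_def)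
    show "E (f s) r" if "s \<in> S1" "r \<in> S2" for s r
      using f(2)[of s] that by (simp add: F_def D_def B_def)
    show "f s \<notin> undominated e" if "s \<in> S1 \<union> S2" "e \<in> M" "s \<in> undominated e" for s e
      using f(2)[OF that(1)] that by (simp add: F_def)
  qed
qed

text \<open>The last disjunction is symmetric in the two cliques, as only a later count decides
  which of them is confined to a part of \<open>R\<close>.\<close>

definition extendable :: "'a set \<Rightarrow> 'a set \<Rightarrow> 'a set \<Rightarrow> 'a set set \<Rightarrow> bool" where
  "extendable R S1 S2 M \<longleftrightarrow> connected_matching V E M \<and> \<Union>M \<subseteq> R
     \<and> (\<forall>s\<in>S1 \<union> S2. \<forall>e\<in>M. \<forall>h\<in>M. s \<in> undominated e \<longrightarrow> s \<in> undominated h \<longrightarrow>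
          undominated e \<inter> R \<noteq> {} \<longrightarrow> undominated h \<inter> R \<noteq> {} \<longrightarrow> e = h)
     \<and> (blocking M S1 R = {} \<or> blocking M S2 R = {}
        \<or> (\<exists>e. blocking M S1 R \<subseteq> {e}) \<and> (\<exists>e. blocking M S2 R \<subseteq> {e}))"

lemma extendableD:
  assumes "extendable R S1 S2 M"
  shows "connected_matching V E M" "\<Union>M \<subseteq> R"
    and "\<And>s e h. \<lbrakk>s \<in> S1 \<union> S2; e \<in> M; h \<in> M; s \<in> undominated e; s \<in> undominated h;
      undominated e \<inter> R \<noteq> {}; undominated h \<inter> R \<noteq> {}\<rbrakk> \<Longrightarrow> e = h"
    and "blocking M S1 R = {} \<or> blocking M S2 R = {}
        \<or> (\<exists>e. blocking M S1 R \<subseteq> {e}) \<and> (\<exists>e. blocking M S2 R \<subseteq> {e})"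
proof -
  note M = assms[unfolded extendable_def]
  show "connected_matching V E M" "\<Union>M \<subseteq> R"
    by (rule conjunct1[OF M], rule conjunct1[OF conjunct2[OF M]])
  show "blocking M S1 R = {} \<or> blocking M S2 R = {}
      \<or> (\<exists>e. blocking M S1 R \<subseteq> {e}) \<and> (\<exists>e. blocking M S2 R \<subseteq> {e})"
    by (rule conjunct2[OF conjunct2[OF conjunct2[OF M]]])
  fix s e h
  assume "s \<in> S1 \<union> S2" "e \<in> M" "h \<in> M" "s \<in> undominated e" "s \<in> undominated h"
    "undominated e \<inter> R \<noteq> {}" "undominated h \<inter> R \<noteq> {}"
  then show "e = h"
    by (rule conjunct1[OF conjunct2[OF conjunct2[OF M]], rule_format])
qed

text \<open>Used to cut down the three-edge matching from a five-cycle when fewer edges are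
  wanted.\<close>

lemma extendable_subset:
  assumes "extendable R S1 S2 M" "N \<subseteq> M"
  shows "extendable R S1 S2 N"
proof -
  note M = extendableD[OF assms(1)]
  have mono: "blocking N S R \<subseteq> blocking M S R" for S
    using assms(2) by (auto simp: blocking_def)
  have single: "\<exists>e. blocking N S R \<subseteq> {e}" if "\<exists>e. blocking M S R \<subseteq> {e}" for S
    using that mono[of S] by blast
  have empty: "blocking N S R = {}" if "blocking M S R = {}" for S
    using that mono[of S] by blast
  show ?thesis
    unfolding extendable_def
  proof (intro conjI ballI impI)
    show "connected_matching V E N"
      by (rule connected_matching_subset[OF M(1) assms(2)])
    show "\<Union>N \<subseteq> R" using M(2) assms(2) by blast
    show "blocking N S1 R = {} \<or> blocking N S2 R = {}
        \<or> (\<exists>e. blocking N S1 R \<subseteq> {e}) \<and> (\<exists>e. blocking N S2 R \<subseteq> {e})"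
      using M(4) by (elim disjE conjE) (simp_all add: single empty)
  next
    fix s e h
    assume "s \<in> S1 \<union> S2" "e \<in> N" "h \<in> N" "s \<in> undominated e" "s \<in> undominated h"
      "undominated e \<inter> R \<noteq> {}" "undominated h \<inter> R \<noteq> {}"
    then show "e = h" using assms(2) by (intro M(3)[of s e h]) auto
  qed
qed

text \<open>Every vertex of \<open>R\<close> lies in \<open>A\<close> or in \<open>B\<close>. By the
  size of \<open>R\<close>, if \<open>B\<close> is too small to receive \<open>S1\<close>, then
  \<open>A\<close> has ample room for \<open>S2\<close>, and conversely.\<close>

lemma cm_ge_two_sides:
  assumes cl: "clique V E S1" "clique V E S2" and anti: "anti_complete E S1 S2"
    and M: "extendable (V - (S1 \<union> S2)) S1 S2 M"
    and V: "card V + 1 = 4 * (card S1 + card S2 + card M)"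
    and nonadj: "\<And>v. v \<in> V \<Longrightarrow> card (nonadj v) \<le> card S1 + card S2"
  shows "card S1 + card S2 + card M \<le> cm V E"
proof -
  define R where "R = V - (S1 \<union> S2)"
  define A where "A = {z \<in> R. \<forall>s\<in>S1. E z s}"
  define B where "B = {z \<in> R. \<forall>r\<in>S2. E z r}"
  note M' = extendableD[OF M, folded R_def]
  have SV: "S1 \<subseteq> V" "S2 \<subseteq> V" and disj: "S1 \<inter> S2 = {}"
    using cl anti by (auto simp: clique_def anti_complete_def)
  have fin: "finite S1" "finite S2" "finite R"
    using SV finite_subset_V by (auto simp: R_def)
  have anti': "anti_complete E S2 S1"
    using anti unfolding anti_complete_def by (blast dest: adj_sym)
  have "R \<subseteq> A \<union> B"
  proof
    fix z assume z: "z \<in> R"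
    have "E z s \<or> E z r" if "s \<in> S1" "r \<in> S2" for s r
    proof -
      have "s \<noteq> r" "\<not> E s r" using that anti by (auto simp: anti_complete_def)
      then show ?thesis using no_three[of z s r] z that SV by (auto simp: R_def)
    qed
    then show "z \<in> A \<union> B" using z by (auto simp: A_def B_def)
  qed
  then have "card R \<le> card (A \<union> B)"
    using fin(3) by (intro card_mono) (auto simp: A_def B_def)
  also have "\<dots> \<le> card A + card B" by (rule card_Un_le)
  finally have AB: "card R \<le> card A + card B" .
  have cardR: "card R + 1 = 3 * card S1 + 3 * card S2 + 4 * card M"
    using V SV fin disj by (simp add: R_def card_Diff_subset card_Un_disjoint)
  have side1: ?thesis
    if "2 * card M + 2 * card S1 \<le> card B + 1"
      "blocking M S1 R = {} \<or> 2 * card M + 2 * card S1 + (card S1 + card S2) \<le> card B + 2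
      \<or> (\<exists>e. blocking M S1 R \<subseteq> {e}) \<and> 2 * card M + card S1 + (card S1 + card S2) \<le> card B + 1"
    using that unfolding B_def R_def
    by (intro cm_ge_one_side cl anti V nonadj M'[unfolded R_def])
  have side2: ?thesis
    if "2 * card M + 2 * card S2 \<le> card A + 1"
      "blocking M S2 R = {} \<or> 2 * card M + 2 * card S2 + (card S2 + card S1) \<le> card A + 2
      \<or> (\<exists>e. blocking M S2 R \<subseteq> {e}) \<and> 2 * card M + card S2 + (card S2 + card S1) \<le> card A + 1"
  proof -
    have "card S2 + card S1 + card M \<le> cm V E"
      using that V unfolding A_def R_def Un_commute[of S1 S2] add.commute[of "card S1"]
      by (intro cm_ge_one_side cl anti' nonadj[unfolded add.commute[of "card S1"]]
          M'[unfolded R_def Un_commute[of S1 S2]])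
    then show ?thesis by simp
  qed
  consider "blocking M S1 R = {}" | "blocking M S2 R = {}"
    | "\<exists>e. blocking M S1 R \<subseteq> {e}" "\<exists>e. blocking M S2 R \<subseteq> {e}"
    using M'(4) by blast
  then show ?thesis
  proof cases
    case 1
    show ?thesis
    proof (cases "2 * card M + 2 * card S1 \<le> card B + 1")
      case True
      then show ?thesis using 1 by (intro side1) auto
    next
      case False
      then show ?thesis using AB cardR by (intro side2 disjI2[OF disjI1]) linarith+
    qed
  next
    case 2
    show ?thesis
    proof (cases "2 * card M + 2 * card S2 \<le> card A + 1")
      case True
      then show ?thesis using 2 by (intro side2) auto
    next
      case False
      then show ?thesis using AB cardR by (intro side1 disjI2[OF disjI1]) linarith+
    qed
  next
    case 3
    show ?thesis
    \<comment> \<open>If this fails, \<open>card A\<close> exceeds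
      \<open>2 * card M + card S2 + (card S2 + card S1)\<close>, more than \<open>side2\<close> asks
      for.\<close>
    proof (cases "2 * card M + card S1 + (card S1 + card S2) \<le> card B + 1")
      case True
      then show ?thesis using 3(1) by (intro side1) auto
    next
      case False
      then show ?thesis using AB cardR 3(2) by (intro side2 disjI2[OF disjI2] conjI) (assumption | linarith)+
    qed
  qed
qed

subsection \<open>Extendable matchings outside the pair\<close>

definition co_five_cycle :: "'a \<Rightarrow> 'a \<Rightarrow> 'a \<Rightarrow> 'a \<Rightarrow> 'a \<Rightarrow> bool" where
  "co_five_cycle a b c d e \<longleftrightarrow> distinct [a, b, c, d, e]
    \<and> \<not> E a b \<and> \<not> E b c \<and> \<not> E c d \<and> \<not> E d e \<and> \<not> E e a"

lemma co_five_cycle_rotate: "co_five_cycle a b c d e \<Longrightarrow> co_five_cycle b c d e a"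
  by (auto simp: co_five_cycle_def)

text \<open>Both \<open>a\<close> and \<open>c\<close> miss \<open>b\<close>. With rotation, all
  diagonals are edges of the graph.\<close>

lemma co_five_cycle_chord:
  assumes "co_five_cycle a b c d e" "{a, b, c, d, e} \<subseteq> V"
  shows "E a c"
  using assms no_three[of a b c] by (auto simp: co_five_cycle_def)

lemma dominating_matching_exists:
  assumes R: "R \<subseteq> V"
    and no5: "\<And>a b c d e. {a, b, c, d, e} \<subseteq> R \<Longrightarrow> \<not> co_five_cycle a b c d e"
    and cliques: "\<And>Q. clique V E Q \<Longrightarrow> card Q \<le> k"
    and nonadj: "\<And>v. v \<in> V \<Longrightarrow> card (nonadj v) \<le> k"
    and "2 * k + 2 * i \<le> card R"
  shows "\<exists>M. matching V E M \<and> card M = i \<and> \<Union>M \<subseteq> R \<and> (\<forall>e\<in>M. undominated e \<inter> R = {})"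
  using assms(5)
proof (induction i)
  case 0
  show ?case by (intro exI[of _ "{}"]) (simp add: matching_def)
next
  case (Suc i)
  then obtain M where M: "matching V E M" "card M = i" "\<Union>M \<subseteq> R" "\<forall>e\<in>M. undominated e \<inter> R = {}"
    by auto
  have fin: "finite R" "finite (\<Union>M)" "finite M"
    using R M(3) finite_subset_V finite_matching[OF M(1)] by (auto intro: rev_finite_subset)
  have U: "card (\<Union>M) \<le> 2 * i" using card_Union_matching[OF M(1)] M(2) by simp
  have "\<not> R \<subseteq> \<Union>M"
    using U Suc.prems card_mono[OF fin(2), of R] by auto
  then obtain u where u: "u \<in> R" "u \<notin> \<Union>M" by blast
  define L where "L = {w \<in> R. E u w \<and> undominated {u, w} \<inter> R \<noteq> {}}"
  have LL: "E w w'" if ww: "w \<in> L" "w' \<in> L" "w \<noteq> w'" for w w'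
  proof (rule ccontr)
    assume n: "\<not> E w w'"
    obtain x where x: "x \<in> R" "\<not> E u x" "\<not> E w x" "E u w" "w \<in> R"
      using ww(1) by (auto simp: L_def undominated_def)
    obtain x' where x': "x' \<in> R" "\<not> E u x'" "\<not> E w' x'" "E u w'" "w' \<in> R"
      using ww(2) by (auto simp: L_def undominated_def)
    have d: "x \<noteq> w" "x \<noteq> w'" "x' \<noteq> w" "x' \<noteq> w'" "u \<noteq> w" "u \<noteq> w'" "x \<noteq> u" "x' \<noteq> u"
      using x x' adj_sym by auto
    \<comment> \<open>If \<open>x = x'\<close>, then \<open>x\<close>, \<open>w\<close>,
      \<open>w'\<close> are independent. Otherwise \<open>u x w w' x'\<close> is a five-cycle of the
      complement.\<close>
    have "x \<noteq> x'"
      using no_three[of x w w'] x x' n d ww(3) R adj_sym by blast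
    then have "co_five_cycle u x w w' x'"
      using d x x' n ww(3) adj_sym by (auto simp: co_five_cycle_def)
    then show False using no5[of u x w w' x'] u x x' by auto
  qed
  have "E u w" "E w u" "w \<in> V" if "w \<in> L" for w
    using that R by (auto simp: L_def intro: adj_sym)
  then have "clique V E (insert u L)"
    using R u(1) LL by (auto simp: clique_def)
  then have "card (insert u L) \<le> k" by (rule cliques)
  moreover have "u \<notin> L" "finite L" using fin by (auto simp: L_def)
  ultimately have L: "card L + 1 \<le> k" by simp
  have N: "card (nonadj u) \<le> k" using nonadj u(1) R by blast
  have "card (\<Union>M \<union> nonadj u \<union> L) \<le> card (\<Union>M) + card (nonadj u) + card L"
    by (meson add_le_mono1 card_Un_le le_trans)
  then have "\<not> R \<subseteq> \<Union>M \<union> nonadj u \<union> L"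
    using L N U Suc.prems card_mono[of "\<Union>M \<union> nonadj u \<union> L" R] fin \<open>finite L\<close> by auto
  then obtain w where w: "w \<in> R" "w \<notin> \<Union>M" "w \<notin> nonadj u" "w \<notin> L" by blast
  have uw: "E u w" using w(1,3) R by (auto simp: nonadj_def)
  have new: "{u, w} \<notin> M" using u(2) by blast
  show ?case
  proof (intro exI[of _ "insert {u, w} M"] conjI)
    have "\<forall>e\<in>M. e \<inter> {u, w} = {}" using u w by blast
    then show "matching V E (insert {u, w} M)"
      using M(1) uw unfolding matching_def by (auto 0 3 simp: Int_commute)
    show "card (insert {u, w} M) = Suc i" using new fin(3) M(2) by simp
    show "\<Union> (insert {u, w} M) \<subseteq> R" using M(3) u w by auto
    show "\<forall>e\<in>insert {u, w} M. undominated e \<inter> R = {}"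
      using M(4) w(1,4) uw by (auto simp: L_def)
  qed
qed

text \<open>No edge blocks anything, and every end of an edge of \<open>M\<close>, being in
  \<open>R\<close>, has a neighbour in each edge of \<open>M\<close>.\<close>

lemma extendable_dominating_matching:
  assumes "R \<subseteq> V" and M: "matching V E M" "\<Union>M \<subseteq> R"
    and dom: "\<forall>e\<in>M. undominated e \<inter> R = {}"
  shows "extendable R S1 S2 M"
proof -
  have "\<exists>x\<in>e. \<exists>y\<in>h. E x y" if eh: "e \<in> M" "h \<in> M" for e h
  proof -
    obtain u v where "h = {u, v}" by (rule matchingD[OF M(1) eh(2)])
    then have "u \<in> h" "u \<in> R" "u \<in> V" using assms(1) M(2) eh(2) by auto
    then have "u \<notin> undominated e" using dom eh(1) by blast
    then show ?thesis using \<open>u \<in> h\<close> \<open>u \<in> V\<close> by (auto simp: undominated_def)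
  qed
  then have "connected_matching V E M"
    using M(1) by (simp add: connected_matching_def)
  moreover have "blocking M S R = {}" for S
    using dom by (auto simp: blocking_def)
  ultimately show ?thesis using M(2) dom by (simp add: extendable_def)
qed

text \<open>The disjunction \<open>labels\<close> ensures that \<open>{a, c}\<close> blocks neither clique unless one of the
  cliques is blocked by no edge at all.\<close>

lemma extendable_from_cycle:
  assumes SV: "S1 \<subseteq> V" "S2 \<subseteq> V" and R: "R \<subseteq> V - (S1 \<union> S2)" and anti: "anti_complete E S1 S2"
    and cyc: "co_five_cycle a b c d e" and cycR: "{a, b, c, d, e} \<subseteq> R"
    and w: "w \<in> R" "E e w" "w \<notin> {a, b, c, d, e}"
    and labels: "(\<forall>x\<in>{a, b, c, d, e}. S1 \<inter> nonadj x = {})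
      \<or> (\<forall>x\<in>{a, b, c, d, e}. S2 \<inter> nonadj x = {})
      \<or> (S1 \<inter> nonadj a = {}) \<noteq> (S1 \<inter> nonadj c = {})"
  shows "\<exists>M. card M = 3 \<and> extendable R S1 S2 M"
proof -
  have RV: "R \<subseteq> V" "{a, b, c, d, e} \<subseteq> V" using R cycR by auto
  have dist: "a \<noteq> b" "a \<noteq> c" "a \<noteq> d" "a \<noteq> e" "b \<noteq> c" "b \<noteq> d" "b \<noteq> e" "c \<noteq> d" "c \<noteq> e" "d \<noteq> e"
    and non: "\<not> E a b" "\<not> E b c" "\<not> E c d" "\<not> E d e" "\<not> E e a"
    using cyc by (auto simp: co_five_cycle_def)
  note cyc2 = co_five_cycle_rotate[OF cyc]
  note cyc3 = co_five_cycle_rotate[OF cyc2]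
  note cyc4 = co_five_cycle_rotate[OF cyc3]
  note cyc5 = co_five_cycle_rotate[OF cyc4]
  have E: "E a c" "E b d" "E c e" "E d a" "E e b"
    using RV(2) by (auto intro!: co_five_cycle_chord[OF cyc] co_five_cycle_chord[OF cyc2]
      co_five_cycle_chord[OF cyc3] co_five_cycle_chord[OF cyc4] co_five_cycle_chord[OF cyc5])
  \<comment> \<open>The diagonals \<open>ac\<close> and \<open>bd\<close> leave over only
    \<open>e\<close>, whose partner \<open>w\<close> is taken off the cycle.\<close>
  define M where "M = {{a, c}, {b, d}, {e, w}}"
  have neq: "{a, c} \<noteq> {b, d}" "{a, c} \<noteq> {e, w}" "{b, d} \<noteq> {e, w}"
    using dist by (auto simp: doubleton_eq_iff)
  have card: "card M = 3" using neq by (simp add: M_def)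
  have mM: "matching V E M"
    using E w dist by (auto simp: M_def matching_def)
  have con: "connected_matching V E M"
    using mM E by (auto simp: M_def connected_matching_def adj_commute)
  have und: "x \<notin> undominated g" if "g \<in> M" "x \<in> g" for x g
    using that E(1,2) w(2) by (auto simp: M_def undominated_def adj_commute)
  \<comment> \<open>Two different edges of \<open>M\<close> contain consecutive, hence non-adjacent,
    cycle vertices; a vertex undominated by both would complete an independent triple.\<close>
  have far: "g = h" if "g \<in> M" "h \<in> M" "s \<in> V" "s \<in> undominated g" "s \<in> undominated h" for g h s
  proof (rule ccontr)
    assume "g \<noteq> h"
    then have "\<exists>x\<in>g. \<exists>y\<in>h. x \<in> V \<and> y \<in> V \<and> x \<noteq> y \<and> \<not> E x y"
      using that(1,2) non dist RV(2) by (auto simp: M_def adj_commute)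
    then obtain x y where xy: "x \<in> g" "y \<in> h" "x \<in> V" "y \<in> V" "x \<noteq> y" "\<not> E x y" by blast
    then have "x \<noteq> s" "y \<noteq> s" using und that by blast+
    moreover have "\<not> E x s" "\<not> E y s" using xy that by (auto simp: undominated_def)
    ultimately show False using no_three[of x y s] xy that(3) by auto
  qed
  have hit: "S1 \<inter> nonadj x = {} \<or> S2 \<inter> nonadj x = {}" if "x \<in> R" for x
  proof (rule ccontr)
    assume "\<not> ?thesis"
    then obtain s r where sr: "s \<in> S1" "r \<in> S2" "\<not> E x s" "\<not> E x r"
      by (auto simp: nonadj_def)
    then have "s \<noteq> r" "\<not> E s r" "x \<noteq> s" "x \<noteq> r"
      using anti that R by (auto simp: anti_complete_def)
    then show False using no_three[of x s r] sr SV that RV(1) by blast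
  qed
  have block: "S \<inter> nonadj x \<noteq> {}" if "g \<in> blocking M S R" "x \<in> g" for g x S
    using that undominated_subset_nonadj[of x g] by (auto simp: blocking_def)
  have inM: "g \<in> M" if "g \<in> blocking M S R" for g S
    using that by (simp add: blocking_def)
  have no_hit: "blocking M S R = {}" if "\<forall>x\<in>{a, b, c, d, e}. S \<inter> nonadj x = {}" for S
    using that block[of _ S] inM[of _ S] by (fastforce simp: M_def)
  \<comment> \<open>All ends of a blocking edge have non-neighbours in the blocked clique, while by
    \<open>hit\<close> no vertex of \<open>R\<close> has some in both cliques.\<close>
  have disj: "blocking M S1 R \<inter> blocking M S2 R = {}"
  proof (rule ccontr)
    assume "\<not> ?thesis"
    then obtain g where g: "g \<in> blocking M S1 R" "g \<in> blocking M S2 R" by blast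
    obtain x where x: "x \<in> g" "x \<in> R" using inM[OF g(1)] cycR by (auto simp: M_def)
    then show False using hit[OF x(2)] block[OF g(1) x(1)] block[OF g(2) x(1)] by blast
  qed
  have "blocking M S1 R = {} \<or> blocking M S2 R = {}
      \<or> (\<exists>e. blocking M S1 R \<subseteq> {e}) \<and> (\<exists>e. blocking M S2 R \<subseteq> {e})"
    using labels
  proof (elim disjE)
    assume ac: "(S1 \<inter> nonadj a = {}) \<noteq> (S1 \<inter> nonadj c = {})"
    \<comment> \<open>One of \<open>a\<close>, \<open>c\<close> has no non-neighbour in
      \<open>S1\<close>; the other has one, hence none in \<open>S2\<close>. So
      \<open>{a, c}\<close> blocks neither clique.\<close>
    then have "S2 \<inter> nonadj a = {} \<or> S2 \<inter> nonadj c = {}"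
      using hit[of a] hit[of c] cycR by auto
    then have "{a, c} \<notin> blocking M S1 R" "{a, c} \<notin> blocking M S2 R"
      using ac block[of "{a, c}" S1] block[of "{a, c}" S2] by auto
    then have "blocking M S1 R \<subseteq> {{b, d}, {e, w}}" "blocking M S2 R \<subseteq> {{b, d}, {e, w}}"
      using inM[of _ S1] inM[of _ S2] by (auto simp: M_def)
    then show ?thesis using disj by (rule disjoint_subsets_doubleton)
  qed (use no_hit in simp_all)
  moreover have "\<Union>M \<subseteq> R" using cycR w(1) by (auto simp: M_def)
  moreover have "g = h" if "s \<in> S1 \<union> S2" "g \<in> M" "h \<in> M" "s \<in> undominated g" "s \<in> undominated h"
    for s g h
    using that SV by (intro far[of g h s]) auto
  ultimately have "extendable R S1 S2 M"
    unfolding extendable_def using con by (intro conjI ballI impI) simp_all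
  then show ?thesis using card by blast
qed

text \<open>Label each cycle vertex by whether it has a non-neighbour in \<open>S1\<close>. Two ends
  of a diagonal with different labels are rotated to \<open>a\<close> and \<open>c\<close>; if all
  labels agree, one clique is complete to the cycle.\<close>

lemma extendable_from_co_five_cycle:
  assumes SV: "S1 \<subseteq> V" "S2 \<subseteq> V" and R: "R \<subseteq> V - (S1 \<union> S2)"
    and anti: "anti_complete E S1 S2"
    and cyc: "co_five_cycle a b c d e" and cycR: "{a, b, c, d, e} \<subseteq> R"
    and nonadj: "\<And>v. v \<in> V \<Longrightarrow> card (nonadj v) + 3 \<le> card R"
  shows "\<exists>M. card M = 3 \<and> extendable R S1 S2 M"
proof -
  let ?ex = "\<exists>M. card M = 3 \<and> extendable R S1 S2 M"
  let ?h = "\<lambda>x. S1 \<inter> nonadj x = {}"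
  have rotated: ?ex
    if c: "co_five_cycle a' b' c' d' e'" and eq: "{a', b', c', d', e'} = {a, b, c, d, e}"
      and l: "(\<forall>x\<in>{a', b', c', d', e'}. S1 \<inter> nonadj x = {})
      \<or> (\<forall>x\<in>{a', b', c', d', e'}. S2 \<inter> nonadj x = {}) \<or> ?h a' \<noteq> ?h c'"
    for a' b' c' d' e'
  proof -
    have sub: "{a', b', c', d', e'} \<subseteq> R" using eq cycR by simp
    \<comment> \<open>\<open>nonadj e'\<close> contains \<open>a'\<close>, \<open>d'\<close> and
      \<open>e'\<close>, so avoiding \<open>b'\<close> and \<open>c'\<close> too puts
      \<open>w\<close> off the cycle.\<close>
    have "card (nonadj e' \<union> {b', c'}) \<le> card (nonadj e') + card {b', c'}" by (rule card_Un_le)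
    also have "\<dots> < card R"
      using nonadj[of e'] sub R by (auto simp: card_insert_if)
    finally have "\<not> R \<subseteq> nonadj e' \<union> {b', c'}"
      using card_mono[of "nonadj e' \<union> {b', c'}" R] by auto
    then obtain w where w: "w \<in> R" "w \<notin> nonadj e'" "w \<noteq> b'" "w \<noteq> c'" by blast
    have "a' \<in> nonadj e'" "d' \<in> nonadj e'" "e' \<in> nonadj e'"
      using c sub R by (auto simp: nonadj_def co_five_cycle_def adj_commute)
    then have "E e' w" "w \<notin> {a', b', c', d', e'}" using w R by (auto simp: nonadj_def)
    then show ?thesis
      using extendable_from_cycle[OF SV R anti c sub w(1) _ _ l] by blast
  qed
  note cyc2 = co_five_cycle_rotate[OF cyc]
  note cyc3 = co_five_cycle_rotate[OF cyc2]
  note cyc4 = co_five_cycle_rotate[OF cyc3]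
  note cyc5 = co_five_cycle_rotate[OF cyc4]
  \<comment> \<open>These four diagonals form the path \<open>e c a d b\<close>, so equal labels
    along it are equal everywhere.\<close>
  consider "?h a \<noteq> ?h c" | "?h b \<noteq> ?h d" | "?h c \<noteq> ?h e" | "?h d \<noteq> ?h a"
    | "\<forall>x\<in>{a, b, c, d, e}. ?h x" | "\<forall>x\<in>{a, b, c, d, e}. \<not> ?h x"
    by auto
  then show ?thesis
  proof cases
    case 1 then show ?thesis by (intro rotated[OF cyc]) auto
  next
    case 2 then show ?thesis by (intro rotated[OF cyc2]) auto
  next
    case 3 then show ?thesis by (intro rotated[OF cyc3]) auto
  next
    case 4 then show ?thesis by (intro rotated[OF cyc4]) auto
  next
    case 5 then show ?thesis by (intro rotated[OF cyc]) auto
  next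
    case 6
    have "S2 \<inter> nonadj x = {}" if x: "x \<in> {a, b, c, d, e}" for x
    proof (rule ccontr)
      assume "S2 \<inter> nonadj x \<noteq> {}"
      moreover have "S1 \<inter> nonadj x \<noteq> {}" using 6 x by blast
      ultimately obtain s r where sr: "s \<in> S1" "r \<in> S2" "\<not> E x s" "\<not> E x r"
        by (auto simp: nonadj_def)
      moreover have "x \<in> V" "x \<notin> S1" "x \<notin> S2" using x cycR R by auto
      ultimately show False
        using no_three[of x s r] SV anti unfolding anti_complete_def by blast
    qed
    then show ?thesis by (intro rotated[OF cyc]) auto
  qed
qed

section \<open>Contradiction from a maximal pair of cliques\<close>

lemma card_anti_complete_cliques_le:
  assumes t: "t \<ge> 1" and V: "card V + 1 = 4 * t" and cm: "cm V E < t"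
    and cl: "clique V E S1" "clique V E S2" and anti: "anti_complete E S1 S2"
  shows "card S1 + card S2 + 4 \<le> t"
proof (rule ccontr)
  assume large: "\<not> card S1 + card S2 + 4 \<le> t"
  define P where "P T1 T2 \<longleftrightarrow> clique V E T1 \<and> clique V E T2 \<and> anti_complete E T1 T2" for T1 T2
  have small: "card Q < t" if Q: "clique V E Q" for Q
  proof (rule ccontr)
    assume "\<not> card Q < t"
    then obtain Q' where "Q' \<subseteq> Q" "card Q' = t"
      using obtain_subset_with_card_n[of t Q] by auto
    then have "t \<le> cm V E" using cm_ge_of_clique[OF V] clique_subset[OF Q] by blast
    then show False using cm by simp
  qed
  \<comment> \<open>Maximality will bound each clique \<open>Q\<close> through the pair
    \<open>Q\<close>, \<open>{}\<close> and each closed non-neighbourhood through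
    \<open>{v}\<close>, \<open>nonadj v - {v}\<close>. A maximum exists since all totals are below
    \<open>2 * t\<close>.\<close>
  have "\<exists>T. P (fst T) (snd T) \<and> (\<forall>U. P (fst U) (snd U) \<longrightarrow>
      card (fst U) + card (snd U) \<le> card (fst T) + card (snd T))"
  proof (rule ex_has_greatest_nat[of _ "(S1, S2)" _ "2 * t"])
    show "P (fst (S1, S2)) (snd (S1, S2))" using cl anti by (simp add: P_def)
    show "\<forall>U. P (fst U) (snd U) \<longrightarrow> card (fst U) + card (snd U) < 2 * t"
      using add_strict_mono[OF small small] by (auto simp: P_def mult_2)
  qed
  then obtain T1 T2 where T: "P T1 T2"
    and max: "\<And>U1 U2. P U1 U2 \<Longrightarrow> card U1 + card U2 \<le> card T1 + card T2"
    by force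
  define k where "k = card T1 + card T2"
  have kS: "t \<le> k + 3" using max[of S1 S2] cl anti large by (simp add: P_def k_def)
  have clT: "clique V E T1" "clique V E T2" and antiT: "anti_complete E T1 T2"
    using T by (auto simp: P_def)
  have nonadj_card: "card (nonadj v) = card (nonadj v - {v}) + 1" if "v \<in> V" for v
  proof -
    have "v \<in> nonadj v" using that by (simp add: nonadj_def)
    then show ?thesis using card_Suc_Diff1[of "nonadj v" v] by simp
  qed
  have finT: "finite T1" "finite T2"
    using clT finite_subset_V by (auto simp: clique_def)
  show False
  proof (cases "t \<le> k")
    case True
    \<comment> \<open>The pair is shrunk to total size exactly \<open>t\<close>, so that the empty
      matching suffices.\<close>
    obtain U1 where U1: "U1 \<subseteq> T1" "card U1 = min t (card T1)"
      using obtain_subset_with_card_n[of "min t (card T1)" T1] by auto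
    have "t - card U1 \<le> card T2" using True U1(2) by (simp add: k_def)
    then obtain U2 where U2: "U2 \<subseteq> T2" "card U2 = t - card U1"
      by (rule obtain_subset_with_card_n)
    have sum: "card U1 + card U2 = t" using U1(2) U2(2) by simp
    have "card U1 + card U2 + card ({} :: 'a set set) \<le> cm V E"
    proof (rule cm_ge_two_sides)
      show "clique V E U1" "clique V E U2" using clT U1 U2 clique_subset by blast+
      show "anti_complete E U1 U2"
        using antiT U1(1) U2(1) unfolding anti_complete_def by blast
      show "extendable (V - (U1 \<union> U2)) U1 U2 {}"
        by (simp add: extendable_def connected_matching_def matching_def blocking_def)
      show "card V + 1 = 4 * (card U1 + card U2 + card ({} :: 'a set set))"
        using V sum by simp
      show "card (nonadj v) \<le> card U1 + card U2" if "v \<in> V" for v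
        using nonadj_card[OF that] small[OF clique_nonadj[OF that]] sum by simp
    qed
    then show False using cm sum by simp
  next
    case False
    define R where "R = V - (T1 \<union> T2)"
    have cliques: "card Q \<le> k" if "clique V E Q" for Q
      using max[of Q "{}"] that by (simp add: P_def k_def clique_def anti_complete_def)
    have nonadj: "card (nonadj v) \<le> k" if "v \<in> V" for v
    proof -
      have "P {v} (nonadj v - {v})"
        unfolding P_def
      proof (intro conjI clique_nonadj that)
        show "clique V E {v}" using that by (simp add: clique_def)
        show "anti_complete E {v} (nonadj v - {v})" by (auto simp: anti_complete_def nonadj_def)
      qed
      from max[OF this] show ?thesis using nonadj_card[OF that] by (simp add: k_def)
    qed
    have "V \<noteq> {}" using V t by auto
    then obtain v where v: "v \<in> V" by blast
    have k1: "1 \<le> k" using nonadj[OF v] nonadj_card[OF v] by simp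
    have TV: "T1 \<subseteq> V" "T2 \<subseteq> V" "T1 \<inter> T2 = {}"
      using clT antiT by (auto simp: clique_def anti_complete_def)
    have cardR: "card R + k + 1 = 4 * t"
    proof -
      have "card (T1 \<union> T2) = k" using finT TV(3) by (simp add: card_Un_disjoint k_def)
      moreover have "card (T1 \<union> T2) \<le> card V" using TV by (intro card_mono) auto
      ultimately show ?thesis
        using V TV finT by (simp add: R_def card_Diff_subset)
    qed
    have RV: "R \<subseteq> V" by (auto simp: R_def)
    \<comment> \<open>Here \<open>1 \<le> t - k \<le> 3\<close>, so the three edges from a
      five-cycle are enough.\<close>
    have "\<exists>M. t - k \<le> card M \<and> extendable R T1 T2 M"
    proof (cases "\<exists>a b c d e. {a, b, c, d, e} \<subseteq> R \<and> co_five_cycle a b c d e")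
      case True
      then obtain a b c d e where "{a, b, c, d, e} \<subseteq> R" "co_five_cycle a b c d e" by blast
      moreover have "card (nonadj v) + 3 \<le> card R" if "v \<in> V" for v
        using nonadj[OF that] cardR False k1 by linarith
      ultimately obtain M where "card M = 3" "extendable R T1 T2 M"
        using extendable_from_co_five_cycle[of T1 T2 R a b c d e] TV antiT by (auto simp: R_def)
      then show ?thesis using kS by (intro exI[of _ M]) simp
    next
      case no5: False
      have n5: "\<not> co_five_cycle a b c d e" if "{a, b, c, d, e} \<subseteq> R" for a b c d e
        using no5 that by blast
      have "2 * k + 2 * (t - k) \<le> card R" using cardR False by linarith
      from dominating_matching_exists[OF RV n5 cliques nonadj this]
      obtain M where "matching V E M" "card M = t - k" "\<Union>M \<subseteq> R"
        "\<forall>e\<in>M. undominated e \<inter> R = {}"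
        by blast
      then show ?thesis
        using extendable_dominating_matching[OF RV, of M] by (intro exI[of _ M]) simp
    qed
    then obtain M where M: "t - k \<le> card M" "extendable R T1 T2 M" by blast
    obtain N where N: "N \<subseteq> M" "card N = t - k"
      using obtain_subset_with_card_n[OF M(1)] by auto
    have sum: "card T1 + card T2 + card N = t" using N(2) False by (simp add: k_def)
    have "card T1 + card T2 + card N \<le> cm V E"
    proof (rule cm_ge_two_sides[OF clT antiT])
      show "extendable (V - (T1 \<union> T2)) T1 T2 N"
        using extendable_subset[OF M(2) N(1)] by (simp add: R_def)
      show "card V + 1 = 4 * (card T1 + card T2 + card N)" using V sum by simp
      show "card (nonadj v) \<le> card T1 + card T2" if "v \<in> V" for v
        using nonadj[OF that] by (simp add: k_def)
    qed
    then show False using cm sum by simp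
  qed
qed

end

theorem theorem1p4:
  fixes V :: "'a set" and E :: "'a \<Rightarrow> 'a \<Rightarrow> bool" and t :: nat
    and S1 S2 :: "'a set"
  assumes "t \<ge> 1"
    and "simple_graph V E"
    and "card V = 4 * t - 1"
    and "independence_number V E = 2"
    and "cm V E \<le> t - 1"
    and "\<forall>t'. 1 \<le> t' \<and> t' < t \<longrightarrow>
           (\<forall>(V' :: nat set) (E' :: nat \<Rightarrow> nat \<Rightarrow> bool).
              simple_graph V' E' \<and> card V' = 4 * t' - 1 \<and> independence_number V' E' = 2
              \<longrightarrow> cm V' E' \<ge> t')"
    and "S1 \<subseteq> V" and "S2 \<subseteq> V" and "S1 \<inter> S2 = {}"
    and "clique V E S1" and "clique V E S2"
    and "anti_complete E S1 S2"
  shows "int (card S1) + int (card S2) \<le> int t - 4"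
proof -
  interpret independence_two V E
  proof
    show "simple_graph V E" by fact
    fix u v w
    assume uvw: "u \<in> V" "v \<in> V" "w \<in> V" "u \<noteq> v" "u \<noteq> w" "v \<noteq> w"
    show "E u v \<or> E u w \<or> E v w"
    proof (rule ccontr)
      assume "\<not> ?thesis"
      then have "independent_set V E {u, v, w}"
        using uvw assms(2) by (auto simp: independent_set_def simple_graph_def)
      moreover have "card {u, v, w} = 3" using uvw by simp
      ultimately have "3 \<in> {card S |S. independent_set V E S}" by (metis (mono_tags) mem_Collect_eq)
      moreover have "finite {card S |S. independent_set V E S}"
      proof -
        have "finite {S. independent_set V E S}"
          by (rule finite_subset[of _ "Pow V"])
            (use assms(2) in \<open>auto simp: independent_set_def simple_graph_def\<close>)
        then show ?thesis by simp
      qed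
      ultimately have "3 \<le> independence_number V E"
        unfolding independence_number_def by (intro Max_ge)
      then show False using assms(4) by simp
    qed
  qed
  \<comment> \<open>The additive form avoids truncated subtraction and so yields the integer bound
    for small \<open>t\<close> as well.\<close>
  have "card S1 + card S2 + 4 \<le> t"
    using assms(1,3,5,10-12) by (intro card_anti_complete_cliques_le) auto
  then show ?thesis by linarith
qed

end
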